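(* The non-disturbance relation is not symmetric: there exist observables $\mathsf{A}$ and $\mathsf{B}$ on $\mathbb{C}^3$ such that $\mathsf{A}$ can be measured without disturbing $\mathsf{B}$, but $\mathsf{B}$ cannot be measured without disturbing $\mathsf{A}$ (i.e. every instrument implementing $\mathsf{B}$ disturbs $\mathsf{A}$).
   Context: Let $\mathcal{H}=\mathbb{C}^3$. An observable on $\mathcal{H}$ is a finite or countably infinite family $\mathsf{A}=\{\mathsf{A}_x\}_{x\in\Omega_{\mathsf{A}}}$ of positive operators on $\mathcal{H}$ with $\sum_x\mathsf{A}_x=\mathbb{1}$ (a discrete POVM). An instrument implementing $\mathsf{A}$ is a family $\mathcal{I}=\{\mathcal{I}_x\}_{x\in\Omega_{\mathsf{A}}}$ of completely positive linear maps on the operators on $\mathcal{H}$ such that $\mathcal{I}_x^*(\mathbb{1})=\mathsf{A}_x$ for all $x$; here the adjoint $\mathcal{I}_x^*$ is defined by $\mathrm{tr}[X\,\mathcal{I}_x(Y)]=\mathrm{tr}[\mathcal{I}_x^*(X)Y]$ for all $X,Y$. Put $\mathcal{I}_\Omega:=\sum_x\mathcal{I}_x$, with adjoint $\mathcal{I}_\Omega^*$. $\mathsf{A}$ can be measured without disturbing $\mathsf{B}$ if there is an instrument $\mathcal{I}$ implementing $\mathsf{A}$ with $\mathcal{I}_\Omega^*(\mathsf{B}_y)=\mathsf{B}_y$ for all $y\in\Omega_{\mathsf{B}}$. *)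

theory Defs
  imports "HOL-Analysis.Analysis"
begin

type_synonym 'n operator = "complex ^ 'n ^ 'n"

(* Inner product of complex^'n, antilinear in the first argument. *)
definition cinner :: "complex ^ 'n \<Rightarrow> complex ^ 'n \<Rightarrow> complex" where
  "cinner v w = (\<Sum>i\<in>UNIV. cnj (v $ i) * w $ i)"

definition positive_operator :: "'n::finite operator \<Rightarrow> bool" where
  "positive_operator A \<longleftrightarrow> (\<forall>v. cinner v (A *v v) \<in> \<real>\<^sub>\<ge>\<^sub>0)"

(* Complex scalar multiplication of matrices (the type class only provides the real one). *)
abbreviation cscale :: "complex \<Rightarrow> 'n::finite operator \<Rightarrow> 'n operator" where
  "cscale c \<equiv> map_matrix ((*) c)"

(* An operator on C^k (x) C^n, given as a k x k block matrix (X i j) of operators on C^n;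
   a vector of C^k (x) C^n is the tuple v 0, ..., v (k-1) of its components in C^n.
   Blocks and components with index >= k are irrelevant. *)
definition positive_block :: "nat \<Rightarrow> (nat \<Rightarrow> nat \<Rightarrow> 'n::finite operator) \<Rightarrow> bool" where
  "positive_block k X \<longleftrightarrow>
     (\<forall>v. (\<Sum>i<k. \<Sum>j<k. cinner (v i) (X i j *v v j)) \<in> \<real>\<^sub>\<ge>\<^sub>0)"

(* id (x) Phi acts blockwise and has to preserve positivity for each k. *)
definition completely_positive :: "('n::finite operator \<Rightarrow> 'n operator) \<Rightarrow> bool" where
  "completely_positive \<Phi> \<longleftrightarrow>
     (\<forall>k X. positive_block k X \<longrightarrow> positive_block k (\<lambda>i j. \<Phi> (X i j)))"

(* The adjoint with respect to the bilinear trace pairing. It exists and is unique exactly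
   for complex linear maps, see trace_adjoint below; on other maps the value is arbitrary. *)
definition trace_adjoint ::
    "('n::finite operator \<Rightarrow> 'n operator) \<Rightarrow> 'n operator \<Rightarrow> 'n operator" where
  "trace_adjoint \<Phi> = (THE \<Psi>. \<forall>X Y. trace (X ** \<Phi> Y) = trace (\<Psi> X ** Y))"

definition observable :: "'x set \<Rightarrow> ('x \<Rightarrow> 'n::finite operator) \<Rightarrow> bool" where
  "observable \<Omega> A \<longleftrightarrow>
     countable \<Omega> \<and> (\<forall>x\<in>\<Omega>. positive_operator (A x)) \<and> (A has_sum mat 1) \<Omega>"

definition implements ::
    "('x \<Rightarrow> 'n::finite operator \<Rightarrow> 'n operator) \<Rightarrow> 'x set \<Rightarrow> ('x \<Rightarrow> 'n operator) \<Rightarrow> bool" where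
  "implements \<I> \<Omega> A \<longleftrightarrow>
     (\<forall>x\<in>\<Omega>. Vector_Spaces.linear cscale cscale (\<I> x) \<and> completely_positive (\<I> x)
            \<and> trace_adjoint (\<I> x) (mat 1) = A x)"

(* If the instrument implements an observable, the sum converges: for positive Y the summands
   are positive with traces tr (A x Y), and positive operators span all operators. *)
definition total_map ::
    "'x set \<Rightarrow> ('x \<Rightarrow> 'n::finite operator \<Rightarrow> 'n operator) \<Rightarrow> 'n operator \<Rightarrow> 'n operator" where
  "total_map \<Omega> \<I> Y = (\<Sum>\<^sub>\<infinity>x\<in>\<Omega>. \<I> x Y)"

definition measurable_without_disturbing ::
    "'x set \<Rightarrow> ('x \<Rightarrow> 'n::finite operator) \<Rightarrow> 'y set \<Rightarrow> ('y \<Rightarrow> 'n operator) \<Rightarrow> bool" where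
  "measurable_without_disturbing \<Omega>A A \<Omega>B B \<longleftrightarrow>
     (\<exists>\<I>. implements \<I> \<Omega>A A \<and> (\<forall>y\<in>\<Omega>B. trace_adjoint (total_map \<Omega>A \<I>) (B y) = B y))"

lemma vector_space_cscale: "vector_space (cscale :: complex \<Rightarrow> 'n::finite operator \<Rightarrow> _)"
  by unfold_locales (auto simp: vec_eq_iff algebra_simps)

lemma linear_cscale_iff:
  fixes \<Phi> :: "'n::finite operator \<Rightarrow> 'n operator"
  shows "Vector_Spaces.linear cscale cscale \<Phi> \<longleftrightarrow>
    (\<forall>X Y. \<Phi> (X + Y) = \<Phi> X + \<Phi> Y) \<and> (\<forall>c X. \<Phi> (cscale c X) = cscale c (\<Phi> X))"
  unfolding Vector_Spaces.linear_iff using vector_space_cscale by blast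

lemma trace_adjoint_unique:
  fixes X X' :: "'n::finite operator"
  assumes "\<And>Y. trace (X ** Y) = trace (X' ** Y)"
  shows "X = X'"
proof -
  have *: "trace (Z ** (\<chi> a b. if a = j \<and> b = i then 1 else 0)) = Z $ i $ j"
    for Z :: "'n operator" and i j
  proof -
    have "trace (Z ** (\<chi> a b. if a = j \<and> b = i then 1 else 0)) =
       (\<Sum>a\<in>UNIV. \<Sum>k\<in>UNIV. if k = j then if a = i then Z $ a $ k else 0 else 0)"
      unfolding trace_def matrix_matrix_mult_def vec_lambda_beta
      by (intro sum.cong refl) simp
    also have "\<dots> = Z $ i $ j" by simp
    finally show ?thesis .
  qed
  show ?thesis unfolding vec_eq_iff using assms * by metis
qed

lemma trace_adjoint:
  fixes \<Phi> :: "'n::finite operator \<Rightarrow> 'n operator"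
  assumes "Vector_Spaces.linear cscale cscale \<Phi>"
  shows "trace (X ** \<Phi> Y) = trace (trace_adjoint \<Phi> X ** Y)"
proof -
  interpret Vector_Spaces.linear cscale cscale \<Phi> by (fact assms)
  define E :: "'n \<Rightarrow> 'n \<Rightarrow> 'n operator"
    where "E = (\<lambda>j i. \<chi> a b. if a = j \<and> b = i then 1 else 0)"
  define \<Psi> :: "'n operator \<Rightarrow> 'n operator"
    where "\<Psi> = (\<lambda>X. \<chi> i j. trace (X ** \<Phi> (E j i)))"
  have E: "Y = (\<Sum>i\<in>UNIV. \<Sum>j\<in>UNIV. cscale (Y $ j $ i) (E j i))" for Y :: "'n operator"
  proof -
    have "(\<Sum>i\<in>UNIV. \<Sum>j\<in>UNIV. Y $ j $ i * E j i $ a $ b) = Y $ a $ b" for a b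
    proof -
      have "(\<Sum>i\<in>UNIV. \<Sum>j\<in>UNIV. Y $ j $ i * E j i $ a $ b) =
        (\<Sum>i\<in>UNIV. \<Sum>j\<in>UNIV. if j = a then if i = b then Y $ j $ i else 0 else 0)"
        unfolding E_def vec_lambda_beta by (intro sum.cong refl) simp
      also have "\<dots> = Y $ a $ b" by simp
      finally show ?thesis .
    qed
    then show ?thesis by (simp add: vec_eq_iff)
  qed
  have tr_sum: "trace (X ** sum f S) = (\<Sum>s\<in>S. trace (X ** f s))"
    if "finite S" for X :: "'n operator" and f :: "'n \<Rightarrow> 'n operator" and S
    using that by (induction S rule: finite_induct)
      (simp_all add: trace_add matrix_add_ldistrib trace_0 matrix_matrix_mult_def trace_def
        sum.distrib algebra_simps)
  have tr_scale: "trace (X ** cscale c Z) = c * trace (X ** Z)" for X Z :: "'n operator" and c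
    by (simp add: trace_def matrix_matrix_mult_def sum_distrib_left algebra_simps)
  have \<Psi>: "trace (X ** \<Phi> Y) = trace (\<Psi> X ** Y)" for X Y
  proof -
    have "\<Phi> Y = (\<Sum>i\<in>UNIV. \<Sum>j\<in>UNIV. cscale (Y $ j $ i) (\<Phi> (E j i)))"
      by (subst E) (simp add: sum scale)
    then have "trace (X ** \<Phi> Y) = (\<Sum>i\<in>UNIV. \<Sum>j\<in>UNIV. Y $ j $ i * trace (X ** \<Phi> (E j i)))"
      by (simp add: tr_sum tr_scale)
    also have "\<dots> = trace (\<Psi> X ** Y)"
      by (simp add: \<Psi>_def trace_def matrix_matrix_mult_def mult.commute)
    finally show ?thesis .
  qed
  have "\<forall>X Y. trace (X ** \<Phi> Y) = trace (trace_adjoint \<Phi> X ** Y)"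
    unfolding trace_adjoint_def
  proof (rule theI[where a = \<Psi>])
    show "\<forall>X Y. trace (X ** \<Phi> Y) = trace (\<Psi> X ** Y)" using \<Psi> by blast
    show "\<Psi>' = \<Psi>" if "\<forall>X Y. trace (X ** \<Phi> Y) = trace (\<Psi>' X ** Y)" for \<Psi>'
      using that \<Psi> by (intro ext trace_adjoint_unique) metis
  qed
  then show ?thesis by blast
qed

end

theory Submission
  imports Defs
begin

text \<open>
  Let \<open>\<A>\<close> consist of multiples of the projections onto four vectors \<open>v k\<close> of which any three
  are linearly independent, grouped into two pairs whose sums are the diagonal effects \<open>\<B> 0\<close>
  and \<open>\<B> 1\<close>. Measuring \<open>\<A>\<close> and then preparing the first or second basis vector according to
  the pair does not disturb \<open>\<B>\<close>, because \<open>\<B>\<close> distinguishes these two basis vectors perfectly.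
  Conversely, let \<open>\<Phi>\<close> be an operation of an instrument that does not disturb \<open>\<A>\<close>. By complete
  positivity every \<open>v k\<close> is an eigenvector of the adjoint of each map \<open>y \<mapsto> \<Phi> (y x\<^sup>*) w\<close>;
  four such eigenvectors force this map to be a scalar. The trace condition then gives
  \<open>\<Phi> X = X B\<close> for the effect \<open>B\<close> implemented by \<open>\<Phi>\<close>, which preserves positivity only if \<open>B\<close>
  is a multiple of the identity.
\<close>

section \<open>Rank-one operators and the inner product\<close>

definition outer :: "complex ^ 'n \<Rightarrow> complex ^ 'n \<Rightarrow> 'n::finite operator" where
  "outer y x = (\<chi> i j. y $ i * cnj (x $ j))"

lemma outer_nth [simp]: "outer y x $ i $ j = y $ i * cnj (x $ j)"
  by (simp add: outer_def)

lemma outer_mult_vector: "outer y x *v w = cinner x w *s y"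
  by (simp add: vec_eq_iff matrix_vector_mult_def cinner_def sum_distrib_left mult_ac)

lemma outer_linear_left:
  "outer (a *s y + b *s z) x = cscale a (outer y x) + cscale b (outer z x)"
  by (simp add: vec_eq_iff algebra_simps)

lemma cinner_commute: "cinner x y = cnj (cinner y x)"
  by (simp add: cinner_def mult.commute)

lemma cinner_scale_left: "cinner (c *s x) y = cnj c * cinner x y"
  by (simp add: cinner_def sum_distrib_left mult_ac)

lemma cinner_scale_right: "cinner x (c *s y) = c * cinner x y"
  by (simp add: cinner_def sum_distrib_left mult_ac)

lemma cinner_add_right: "cinner x (y + z) = cinner x y + cinner x z"
  by (simp add: cinner_def sum.distrib algebra_simps)

lemma cscale_mult_vector: "cscale c M *v w = c *s (M *v w)"
  by (simp add: vec_eq_iff matrix_vector_mult_def sum_distrib_left mult_ac)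

lemma matrix_vector_mult_axis_nth: "(M *v axis j 1) $ i = M $ i $ j" for M :: "'n::finite operator"
  by (simp add: matrix_vector_mult_def axis_def if_distrib cong: if_cong)

lemma trace_outer_mult: "trace (outer y x ** M) = cinner x (M *v y)"
proof -
  have "trace (outer y x ** M) = (\<Sum>i\<in>UNIV. \<Sum>k\<in>UNIV. y $ i * cnj (x $ k) * M $ k $ i)"
    by (simp add: trace_def matrix_matrix_mult_def)
  also have "\<dots> = (\<Sum>k\<in>UNIV. \<Sum>i\<in>UNIV. y $ i * cnj (x $ k) * M $ k $ i)"
    by (rule sum.swap)
  also have "\<dots> = cinner x (M *v y)"
    by (simp add: cinner_def matrix_vector_mult_def sum_distrib_left mult_ac)
  finally show ?thesis .
qed

lemma trace_cscale_mult: "trace (cscale c X ** M) = c * trace (X ** M)"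
  by (simp add: trace_def matrix_matrix_mult_def sum_distrib_left mult_ac)

lemma trace_mult_cscale: "trace (X ** cscale c M) = c * trace (X ** M)"
  by (simp add: trace_def matrix_matrix_mult_def sum_distrib_left mult_ac)

section \<open>Positivity and complete positivity\<close>

lemma nonneg_cnj_mult_self: "cnj z * z \<in> \<real>\<^sub>\<ge>\<^sub>0"
  by (simp add: complex_nonneg_Reals_iff)

lemma positive_operator_scale_outer:
  assumes "r \<ge> 0"
  shows "positive_operator (cscale (of_real r) (outer v v))"
proof -
  have "cinner w (cscale (of_real r) (outer v v) *v w) =
      of_real r * (cnj (cinner v w) * cinner v w)" for w
    by (simp add: cscale_mult_vector outer_mult_vector cinner_scale_right cinner_commute[of w v])
  then show ?thesis
    using assms by (simp add: positive_operator_def nonneg_cnj_mult_self nonneg_Reals_mult_I)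
qed

text \<open>These are the blocks of the rank-one operator onto the tuple \<open>y\<close>, so the
  quadratic form is a squared modulus.\<close>

lemma positive_block_outer: "positive_block k (\<lambda>i j. outer (y i) (y j))"
  unfolding positive_block_def
proof
  fix v
  define c where "c = (\<Sum>i<k. cinner (y i) (v i))"
  have "(\<Sum>i<k. \<Sum>j<k. cinner (v i) (outer (y i) (y j) *v v j)) =
      (\<Sum>i<k. \<Sum>j<k. cnj (cinner (y i) (v i)) * cinner (y j) (v j))"
    by (intro sum.cong refl)
      (simp add: outer_mult_vector cinner_scale_right cinner_commute[of "v _" "y _"])
  also have "\<dots> = cnj c * c"
    by (simp add: c_def sum_product)
  finally show "(\<Sum>i<k. \<Sum>j<k. cinner (v i) (outer (y i) (y j) *v v j)) \<in> \<real>\<^sub>\<ge>\<^sub>0"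
    by (simp only: nonneg_cnj_mult_self)
qed

lemma completely_positive_outer:
  fixes w y :: "nat \<Rightarrow> complex ^ 'n::finite"
  assumes "completely_positive \<Phi>"
  shows "(\<Sum>i<k. \<Sum>j<k. cinner (w i) (\<Phi> (outer (y i) (y j)) *v w j)) \<in> \<real>\<^sub>\<ge>\<^sub>0"
proof -
  have "positive_block k (\<lambda>i j. \<Phi> (outer (y i) (y j)))"
    using assms positive_block_outer unfolding completely_positive_def by blast
  then show ?thesis by (simp add: positive_block_def)
qed

lemma completely_positive_outer1:
  assumes "completely_positive \<Phi>"
  shows "cinner w (\<Phi> (outer y y) *v w) \<in> \<real>\<^sub>\<ge>\<^sub>0"
  using completely_positive_outer[OF assms, where k = 1 and w = "\<lambda>_. w" and y = "\<lambda>_. y"] by simp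

text \<open>A positive form annihilates its null vectors, as in Cauchy-Schwarz. In the positive 2 x
  2 block form of the pair \<open>y\<close>, \<open>x\<close>, scaling the \<open>v\<close>
  component by \<open>c\<close> leaves only an affine expression in \<open>c\<close>, because the
  quadratic term vanishes.\<close>

lemma completely_positive_outer_eq_0:
  assumes cp: "completely_positive \<Phi>" and zero: "cinner v (\<Phi> (outer y y) *v v) = 0"
  shows "cinner v (\<Phi> (outer y x) *v w) = 0"
proof -
  define a where "a = cinner v (\<Phi> (outer y x) *v w)"
  define b where "b = cinner w (\<Phi> (outer x y) *v v)"
  define d where "d = cinner w (\<Phi> (outer x x) *v w)"
  have pos: "cnj c * a + c * b + d \<in> \<real>\<^sub>\<ge>\<^sub>0" for c
    using completely_positive_outer[OF cp, where k = 2 and w = "\<lambda>i. if i = 0 then c *s v else w"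
        and y = "\<lambda>i. if i = 0 then y else x"] zero
    by (simp add: numeral_2_eq_2 a_def b_def d_def cinner_scale_left cinner_scale_right
        vector_scalar_commute add_ac)
  \<comment> \<open>An affine function of a real variable that stays nonnegative has slope
    zero.\<close>
  have *: "z = 0" if "\<And>t::real. of_real t * z + d \<in> \<real>\<^sub>\<ge>\<^sub>0" for z :: complex
  proof (rule complex_eqI)
    have im: "t * Im z + Im d = 0" and re: "t * Re z + Re d \<ge> 0" for t
      using that[of t] by (auto simp: complex_nonneg_Reals_iff)
    show "Im z = Im 0" using im[of 0] im[of 1] by simp
    show "Re z = Re 0"
    proof (rule ccontr)
      assume "Re z \<noteq> Re 0"
      then show False using re[of "- (Re d + 1) / Re z"] by simp
    qed
  qed
  \<comment> \<open>Real and purely imaginary values of \<open>c\<close> separate \<open>a\<close>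
    from \<open>b\<close>.\<close>
  have "a + b = 0"
    using pos[of "of_real _"] by (intro *) (simp add: algebra_simps)
  moreover have "\<i> * (b - a) = 0"
    using pos[of "of_real _ * \<i>"] by (intro *) (simp add: algebra_simps)
  ultimately have "a = 0" by simp
  then show ?thesis by (simp add: a_def)
qed

text \<open>The map has the single Kraus operator \<open>outer e v\<close> up to the factor
  \<open>r\<close>, so the form of the image at \<open>w\<close> is \<open>r\<close> times the form
  of \<open>X\<close> at the pulled back vectors \<open>?u\<close>.\<close>

lemma completely_positive_measure_prepare:
  assumes "r \<ge> 0"
  shows "completely_positive (\<lambda>Y. cscale (of_real r * cinner v (Y *v v)) (outer e e))"
  unfolding completely_positive_def positive_block_def
proof (intro allI impI)
  fix k and X :: "nat \<Rightarrow> nat \<Rightarrow> 'a operator" and w :: "nat \<Rightarrow> complex ^ 'a"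
  assume X: "\<forall>v. (\<Sum>i<k. \<Sum>j<k. cinner (v i) (X i j *v v j)) \<in> \<real>\<^sub>\<ge>\<^sub>0"
  let ?u = "\<lambda>i. cinner e (w i) *s v"
  have "cinner (w i) (cscale (of_real r * cinner v (X i j *v v)) (outer e e) *v w j) =
      of_real r * cinner (?u i) (X i j *v ?u j)" for i j
    by (simp add: cscale_mult_vector outer_mult_vector cinner_scale_right cinner_scale_left
        vector_scalar_commute cinner_commute[of "w i" e])
  then have "(\<Sum>i<k. \<Sum>j<k. cinner (w i)
        (cscale (of_real r * cinner v (X i j *v v)) (outer e e) *v w j)) =
      of_real r * (\<Sum>i<k. \<Sum>j<k. cinner (?u i) (X i j *v ?u j))"
    by (simp add: sum_distrib_left)
  moreover have "\<dots> \<in> \<real>\<^sub>\<ge>\<^sub>0"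
    using X assms by (intro nonneg_Reals_mult_I) auto
  ultimately show "(\<Sum>i<k. \<Sum>j<k. cinner (w i)
        (cscale (of_real r * cinner v (X i j *v v)) (outer e e) *v w j)) \<in> \<real>\<^sub>\<ge>\<^sub>0"
    by simp
qed

section \<open>Trace adjoints\<close>

lemma matrix_matrix_add_rdistrib: "(X + Y) ** Z = X ** Z + Y ** Z"
  for X Y :: "'n::finite operator"
  by (simp add: vec_eq_iff matrix_matrix_mult_def sum.distrib algebra_simps)

lemma trace_adjoint_eqI:
  assumes "\<And>X Y. trace (X ** \<Phi> Y) = trace (\<Psi> X ** Y)"
  shows "trace_adjoint \<Phi> = \<Psi>"
  unfolding trace_adjoint_def
proof (rule the_equality)
  show "\<forall>X Y. trace (X ** \<Phi> Y) = trace (\<Psi> X ** Y)" using assms by blast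
  show "\<Psi>' = \<Psi>" if "\<forall>X Y. trace (X ** \<Phi> Y) = trace (\<Psi>' X ** Y)" for \<Psi>'
    using that assms by (intro ext trace_adjoint_unique) metis
qed

section \<open>The two observables\<close>

text \<open>The third components satisfy \<open>3\<^sup>2 + 4\<^sup>2 = 5\<^sup>2\<close>, so that the \<open>\<A> k\<close> sum to the identity.\<close>

definition v :: "nat \<Rightarrow> complex ^ 3" where
  "v k = (if k = 0 then vector [5, 0, 3] else if k = 1 then vector [5, 0, -3]
          else if k = 2 then vector [0, 5, 4] else vector [0, 5, -4])"

definition \<A> :: "nat \<Rightarrow> complex ^ 3 ^ 3" where
  "\<A> k = cscale (of_real (1/50)) (outer (v k) (v k))"

definition \<B> :: "nat \<Rightarrow> complex ^ 3 ^ 3" where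
  "\<B> y = (if y = 0 then \<A> 0 + \<A> 1 else \<A> 2 + \<A> 3)"

lemmas components_3 = vec_eq_iff forall_3 sum_3 vector_3

lemma axis_3 [simp]:
  "axis (1::3) c = vector [c, 0, 0]" "axis (2::3) c = vector [0, c, 0]"
  "axis (3::3) c = vector [0, 0, c]" for c :: complex
  by (simp_all add: components_3 axis_def)

text \<open>The third components within a pair have opposite signs, so the off-diagonal terms
  cancel. The eigenvalues 1 and 0 on the first two basis vectors serve both halves of the
  proof.\<close>

lemma \<B>_nth:
  "\<B> 0 = vector [vector [1, 0, 0], vector [0, 0, 0], vector [0, 0, 9/25]]"
  "\<B> 1 = vector [vector [0, 0, 0], vector [0, 1, 0], vector [0, 0, 16/25]]"
  by (simp_all add: components_3 \<B>_def \<A>_def v_def)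

lemma positive_operator_add:
  assumes "positive_operator X" "positive_operator Y"
  shows "positive_operator (X + Y)"
  using assms by (simp add: positive_operator_def matrix_vector_mult_add_rdistrib cinner_add_right)

lemma positive_\<A>: "positive_operator (\<A> k)"
  unfolding \<A>_def by (rule positive_operator_scale_outer) simp

lemma sum_\<A>: "(\<Sum>k<4. \<A> k) = mat 1"
  by (simp add: numeral_eq_Suc lessThan_Suc components_3 \<A>_def v_def mat_def)

lemma sum_\<B>: "(\<Sum>y<2. \<B> y) = mat 1"
  unfolding sum_\<A>[symmetric] by (simp add: numeral_eq_Suc lessThan_Suc \<B>_def)

lemma observable_\<A>: "observable {..<4} \<A>"
  unfolding observable_def using positive_\<A> sum_\<A> has_sum_finite[of "{..<4}" \<A>] by auto

lemma observable_\<B>: "observable {..<2} \<B>"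
proof -
  have "positive_operator (\<B> y)" for y
    by (simp add: \<B>_def positive_\<A> positive_operator_add)
  then show ?thesis
    unfolding observable_def using sum_\<B> has_sum_finite[of "{..<2}" \<B>] by auto
qed

section \<open>A nondisturbing instrument for \<open>\<A>\<close>\<close>

lemma \<A>_not_disturbing_\<B>: "measurable_without_disturbing {..<4} \<A> {..<2} \<B>"
proof -
  define e :: "nat \<Rightarrow> complex ^ 3" where "e k = axis (if k < 2 then 1 else 2) 1" for k
  define \<I> where
    "\<I> k Y = cscale (of_real (1/50) * cinner (v k) (Y *v v k)) (outer (e k) (e k))" for k Y
  have adj: "trace (X ** \<I> k Y) = trace (cscale (cinner (e k) (X *v e k)) (\<A> k) ** Y)" for k X Y
    by (simp add: \<I>_def \<A>_def trace_cscale_mult trace_mult_cscale trace_outer_mult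
        trace_mul_sym[of X])
  then have adjoint: "trace_adjoint (\<I> k) = (\<lambda>X. cscale (cinner (e k) (X *v e k)) (\<A> k))" for k
    by (rule trace_adjoint_eqI)
  have "implements \<I> {..<4} \<A>"
    unfolding implements_def
  proof (intro ballI conjI)
    fix k
    show "Vector_Spaces.linear cscale cscale (\<I> k)"
      unfolding linear_cscale_iff \<I>_def
      by (simp add: matrix_vector_mult_add_rdistrib cinner_add_right cscale_mult_vector
          cinner_scale_right vec_eq_iff algebra_simps)
    show "completely_positive (\<I> k)"
      unfolding \<I>_def by (rule completely_positive_measure_prepare) simp
    have "cinner (e k) (e k) = 1"
      by (simp add: e_def cinner_def sum_3)
    then show "trace_adjoint (\<I> k) (mat 1) = \<A> k"
      by (simp add: adjoint vec_eq_iff)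
  qed
  moreover have "trace_adjoint (total_map {..<4} \<I>) (\<B> y) = \<B> y" if "y \<in> {..<2}" for y
  proof -
    have "trace_adjoint (total_map {..<4} \<I>) =
        (\<lambda>X. \<Sum>k<4. cscale (cinner (e k) (X *v e k)) (\<A> k))"
    proof (rule trace_adjoint_eqI)
      show "trace (X ** total_map {..<4} \<I> Y) =
          trace ((\<Sum>k<4. cscale (cinner (e k) (X *v e k)) (\<A> k)) ** Y)" for X Y
        by (simp add: total_map_def numeral_eq_Suc lessThan_Suc matrix_add_ldistrib
            matrix_matrix_add_rdistrib trace_add adj)
    qed
    moreover have "(\<Sum>k<4. cscale (cinner (e k) (\<B> y *v e k)) (\<A> k)) = \<B> y"
    proof -
      have "y = 0 \<or> y = 1" using that by auto
      \<comment> \<open>\<open>e k\<close> is an eigenvector of \<open>\<B> y\<close>, so exactly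
        the two effects of pair \<open>y\<close> survive in the sum.\<close>
      then have "cinner (e k) (\<B> y *v e k) = (if (k < 2) = (y = 0) then 1 else 0)" for k
        using \<B>_nth by (auto simp: e_def cinner_def matrix_vector_mult_def sum_3)
      then show ?thesis
        by (simp add: numeral_eq_Suc lessThan_Suc \<B>_def vec_eq_iff)
    qed
    ultimately show ?thesis by simp
  qed
  ultimately show ?thesis
    unfolding measurable_without_disturbing_def by blast
qed

section \<open>Every instrument for \<open>\<B>\<close> disturbs \<open>\<A>\<close>\<close>

text \<open>Each pair \<open>v 0\<close>, \<open>v 1\<close> and \<open>v 2\<close>,
  \<open>v 3\<close> spans a coordinate plane, so its orthogonal basis vector is an eigenvector of
  \<open>L\<close>. Vectors orthogonal to a single \<open>v k\<close> then tie all eigenvalues to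
  that of the third basis vector.\<close>

lemma scalar_if_preserves_orthogonality:
  fixes L :: "complex ^ 3 \<Rightarrow> complex ^ 3"
  assumes lin: "\<And>a b y z. L (a *s y + b *s z) = a *s L y + b *s L z"
    and orth: "\<And>k y. k < 4 \<Longrightarrow> cinner (v k) y = 0 \<Longrightarrow> cinner (v k) (L y) = 0"
  shows "\<exists>c. \<forall>y. L y = c *s y"
proof -
  define l where "l j = L (axis j 1)" for j
  have L: "L y = y $ 1 *s l 1 + y $ 2 *s l 2 + y $ 3 *s l 3" for y
  proof -
    \<comment> \<open>The factor 1 gives the nested sum the two-term shape of \<open>lin\<close>,
      which then applies twice.\<close>
    have "y = 1 *s (y $ 1 *s axis 1 1 + y $ 2 *s axis 2 1) + y $ 3 *s axis 3 1"
      by (simp add: components_3)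
    then have "L y = L (1 *s (y $ 1 *s axis 1 1 + y $ 2 *s axis 2 1) + y $ 3 *s axis 3 1)"
      by simp
    also have "\<dots> = y $ 1 *s l 1 + y $ 2 *s l 2 + y $ 3 *s l 3"
      by (simp only: lin l_def) simp
    finally show ?thesis .
  qed
  note eqs = orth[unfolded cinner_def L v_def sum_3]
  have 1: "l 1 $ 2 = 0 \<and> l 1 $ 3 = 0"
    using eqs[of 2 "axis 1 1"] eqs[of 3 "axis 1 1"] by simp
  have 2: "l 2 $ 1 = 0 \<and> l 2 $ 3 = 0"
    using eqs[of 0 "axis 2 1"] eqs[of 1 "axis 2 1"] by simp
  \<comment> \<open>The two test vectors are orthogonal to \<open>v 0\<close> and \<open>v 1\<close>
    respectively; the sum and difference of the equations give the two claims.\<close>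
  have 3: "l 3 $ 1 = 0 \<and> l 3 $ 3 = l 1 $ 1"
    using eqs[of 0 "vector [3, 0, -5]"] eqs[of 1 "vector [3, 0, 5]"] 1 by simp algebra
  have 4: "l 3 $ 2 = 0 \<and> l 3 $ 3 = l 2 $ 2"
    using eqs[of 2 "vector [0, 4, -5]"] eqs[of 3 "vector [0, 4, 5]"] 2 by simp algebra
  have "L y = l 1 $ 1 *s y" for y
    using 1 2 3 4 unfolding L by (simp add: components_3 mult.commute)
  then show ?thesis by blast
qed

lemma \<B>_disturbing_\<A>: "\<not> measurable_without_disturbing {..<2} \<B> {..<4} \<A>"
proof
  assume "measurable_without_disturbing {..<2} \<B> {..<4} \<A>"
  then obtain \<I> where impl: "implements \<I> {..<2} \<B>"
    and fixed: "\<And>k. k < 4 \<Longrightarrow> trace_adjoint (total_map {..<2} \<I>) (\<A> k) = \<A> k"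
    unfolding measurable_without_disturbing_def by auto
  have lin: "Vector_Spaces.linear cscale cscale (\<I> y)" and cp: "completely_positive (\<I> y)"
    and adjoint: "trace_adjoint (\<I> y) (mat 1) = \<B> y" if "y < 2" for y
    using impl that by (auto simp: implements_def)
  have total: "total_map {..<2} \<I> Y = \<I> 0 Y + \<I> 1 Y" for Y
    by (simp add: total_map_def numeral_2_eq_2)
  have "Vector_Spaces.linear cscale cscale (total_map {..<2} \<I>)"
    using lin[of 0] lin[of 1] unfolding linear_cscale_iff total
    by (simp add: vec_eq_iff algebra_simps)
  then have trace_total: "trace (\<A> k ** total_map {..<2} \<I> Y) = trace (\<A> k ** Y)"
    if "k < 4" for k Y
    using trace_adjoint fixed[OF that] by metis
  have vv: "cinner (v k) (\<I> 0 Y *v v k) + cinner (v k) (\<I> 1 Y *v v k) = cinner (v k) (Y *v v k)"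
    if "k < 4" for k Y
    using trace_total[OF that, of Y]
    by (simp add: total \<A>_def trace_cscale_mult trace_outer_mult matrix_vector_mult_add_rdistrib
        cinner_add_right del: One_nat_def) algebra
  define \<Phi> where "\<Phi> = \<I> 0"
  have cp\<Phi>: "completely_positive \<Phi>" and lin\<Phi>: "Vector_Spaces.linear cscale cscale \<Phi>"
    using cp lin by (simp_all add: \<Phi>_def)
  \<comment> \<open>The nonnegative contributions of both outcomes add up to the squared modulus of
    \<open>cinner (v k) y\<close>, which is zero, so each vanishes.\<close>
  have orth: "cinner (v k) (\<Phi> (outer y x) *v w) = 0" if "k < 4" "cinner (v k) y = 0" for k y x w
  proof (rule completely_positive_outer_eq_0[OF cp\<Phi>])
    have "cinner (v k) (\<I> 0 (outer y y) *v v k) + cinner (v k) (\<I> 1 (outer y y) *v v k) = 0"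
      using that by (simp only: vv) (simp add: outer_mult_vector cinner_scale_right)
    moreover have "cinner (v k) (\<I> j (outer y y) *v v k) \<in> \<real>\<^sub>\<ge>\<^sub>0" if "j < 2" for j
      using completely_positive_outer1[OF cp[OF that]] .
    from this[of 0] this[of 1]
    have "cinner (v k) (\<I> 0 (outer y y) *v v k) \<in> \<real>\<^sub>\<ge>\<^sub>0" "cinner (v k) (\<I> 1 (outer y y) *v v k) \<in> \<real>\<^sub>\<ge>\<^sub>0"
      by simp_all
    ultimately show "cinner (v k) (\<Phi> (outer y y) *v v k) = 0"
      by (auto simp: \<Phi>_def complex_nonneg_Reals_iff complex_eq_iff)
  qed
  \<comment> \<open>\<open>u\<close> superposes eigenvectors of \<open>\<B> 0\<close> with different
    eigenvalues, so \<open>outer u u ** \<B> 0\<close> is not even Hermitian.\<close>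
  define u :: "complex ^ 3" where "u = vector [1, 1, 0]"
  have u_nth [simp]: "u $ 1 = 1" "u $ 2 = 1" "u $ 3 = 0"
    by (simp_all add: u_def)
  have "\<exists>c. \<forall>y. \<Phi> (outer y u) *v w = c *s y" for w
  proof (rule scalar_if_preserves_orthogonality)
    show "\<Phi> (outer (a *s y + b *s z) u) *v w =
        a *s (\<Phi> (outer y u) *v w) + b *s (\<Phi> (outer z u) *v w)" for a b y z
      using lin\<Phi> unfolding linear_cscale_iff
      by (simp add: outer_linear_left matrix_vector_mult_add_rdistrib cscale_mult_vector)
  qed (rule orth)
  then obtain c where c: "\<Phi> (outer y u) *v w = c w *s y" for y w
    by metis
  have nth: "\<Phi> (outer y u) $ i $ j = c (axis j 1) * y $ i" for y i j
    using c[of y "axis j 1"] by (simp add: vec_eq_iff matrix_vector_mult_axis_nth del: axis_3)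
  have "trace (\<Phi> Y) = trace (\<B> 0 ** Y)" for Y
    using trace_adjoint[OF lin\<Phi>, of "mat 1" Y] adjoint[of 0] by (simp add: \<Phi>_def)
  then have "trace (\<Phi> (outer y u)) = y $ 1" for y
    using \<B>_nth by (simp add: trace_def matrix_matrix_mult_def sum_3)
  then have tr: "c (axis 1 1) * y $ 1 + c (axis 2 1) * y $ 2 + c (axis 3 1) * y $ 3 = y $ 1"
    for y :: "complex ^ 3"
    by (simp add: trace_def nth sum_3 del: axis_3)
  \<comment> \<open>These are the first two entries of the row vector by which
    \<open>\<Phi> (outer y u)\<close> multiplies \<open>y\<close>.\<close>
  have "c (axis 1 1) = 1" "c (axis 2 1) = 0"
    using tr[of "vector [1, 0, 0]"] tr[of "vector [0, 1, 0]"] by (simp_all del: axis_3)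
  \<comment> \<open>The test vector has inner product -1 with \<open>u\<close>, while the functional
    \<open>c\<close> takes the value 1 on it.\<close>
  then have "cinner (vector [1, -2, 0]) (\<Phi> (outer u u) *v vector [1, -2, 0]) = -1"
    by (simp add: cinner_def matrix_vector_mult_def sum_3 nth del: axis_3)
  then show False
    using completely_positive_outer1[OF cp\<Phi>, of "vector [1, -2, 0]" u]
    by (simp add: complex_nonneg_Reals_iff)
qed

theorem mainTheorem3:
  shows "\<exists>(\<Omega>A :: nat set) (A :: nat \<Rightarrow> complex ^ 3 ^ 3) (\<Omega>B :: nat set) (B :: nat \<Rightarrow> complex ^ 3 ^ 3).
    observable \<Omega>A A \<and> observable \<Omega>B B \<and>
    measurable_without_disturbing \<Omega>A A \<Omega>B B \<and>
    \<not> measurable_without_disturbing \<Omega>B B \<Omega>A A"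
  using observable_\<A> observable_\<B> \<A>_not_disturbing_\<B> \<B>_disturbing_\<A> by blast

end
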